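(* Let $\nu>0$. Let $x$ be a point in the interior of $C_N^B$, and let $y\in \mathbb R^N$. Let $\beta_0\ge 1/2$ be such that $\sqrt \beta \cdot x+y$ lies in the interior of $C_N^B$ for all $\beta\ge \beta_0$. For $\beta\ge \beta_0$ consider the Bessel processes $(X_{t,k})_{t\ge0}$ of type $B_N$ with multiplicities $k=(k_1,k_2)=(\beta\cdot\nu ,\beta)$, which start in $\sqrt \beta\cdot x+y$. Then, for all $t>0$, \[\sup_{0\le s\le t,\; \beta\ge\beta_0}\|X_{s,k}- \sqrt\beta\, \phi(s,x) \|<\infty \quad\text{almost surely.}\] In particular, $X_{t,(\nu\cdot\beta,\beta)}/\sqrt \beta\to \phi(t,x)$ for $\beta\to\infty$ locally uniformly in $t$ almost surely, and thus locally uniformly in $t$ in probability.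
   Context: $N$ is the number of particles, $C_N^B:=\{x\in \mathbb R^N: x_1\ge x_2\ge\ldots\ge x_N\ge0\}$, and $\|\cdot\|$ is the Euclidean norm. $(B_t)_{t\ge0}=(B_t^1,\ldots,B_t^N)_{t\ge0}$ is an $N$-dimensional Brownian motion started at $0$. For $k=(k_1,k_2)$ with $k_1,k_2>0$, the Bessel process $(X_{t,k})_{t\ge0}$ of type $B_N$ is the unique strong solution in $C_N^B$, with the given starting point, of \[ dX_{t,k}^i = dB_t^i+ k_2\sum_{j\ne i} \Bigl(\frac{1}{X_{t,k}^i-X_{t,k}^j} + \frac{1}{X_{t,k}^i+X_{t,k}^j}\Bigr) dt + \frac{k_1}{X_{t,k}^i}\, dt \qquad(i=1,\ldots,N).\] The same Brownian motion is used for all $\beta\ge\beta_0$. $\phi(t,x)$ denotes the solution at time $t\ge0$ of the deterministic dynamical system $\frac{d}{dt}x(t)=H(x(t))$ in the interior of $C_N^B$ with $x(0)=x$, where the $i$-th component of $H$ is \[H_i(x)=\sum_{j\ne i}\Bigl( \frac{1}{x_i-x_j}+ \frac{1}{x_i+x_j}\Bigr)+\frac{\nu}{x_i}\qquad(i=1,\ldots,N).\] This solution exists for all $t\ge0$ and stays in the interior of $C_N^B$. *)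

theory Defs
  imports "HOL-Probability.Probability"
begin

(* The N coordinates are indexed by a finite linearly ordered type 'n with CARD('n) = N; its order
   plays the role of the order on 1, ..., N. *)

definition weyl_chamber_B :: "(real ^ 'n::{finite,linorder}) set" where
  "weyl_chamber_B = {x. (\<forall>i j. i \<le> j \<longrightarrow> x $ j \<le> x $ i) \<and> (\<forall>i. 0 \<le> x $ i)}"

definition bessel_drift :: "real \<times> real \<Rightarrow> real ^ 'n::finite \<Rightarrow> real ^ 'n" where
  "bessel_drift k x = (\<chi> i. snd k * (\<Sum>j\<in>UNIV - {i}. 1 / (x $ i - x $ j) + 1 / (x $ i + x $ j))
                             + fst k / x $ i)"

definition limit_field :: "real \<Rightarrow> real ^ 'n::finite \<Rightarrow> real ^ 'n" where
  "limit_field \<nu> x = (\<chi> i. (\<Sum>j\<in>UNIV - {i}. 1 / (x $ i - x $ j) + 1 / (x $ i + x $ j)) + \<nu> / x $ i)"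

definition solves_limit_ode ::
    "real \<Rightarrow> real ^ 'n::{finite,linorder} \<Rightarrow> (real \<Rightarrow> real ^ 'n::{finite,linorder}) \<Rightarrow> bool" where
  "solves_limit_ode \<nu> x u \<longleftrightarrow>
     u 0 = x \<and>
     (\<forall>t\<ge>0. u t \<in> interior weyl_chamber_B \<and>
            (u has_vector_derivative limit_field \<nu> (u t)) (at t within {0..}))"

(* The independence clause says at once that increments over successive time intervals are
   independent and that the coordinates of each increment are independent. *)

definition brownian_motion :: "'a measure \<Rightarrow> (real \<Rightarrow> 'a \<Rightarrow> real ^ 'n::finite) \<Rightarrow> bool" where
  "brownian_motion M B \<longleftrightarrow>
     prob_space M \<and>
     (\<forall>t\<ge>0. B t \<in> borel_measurable M) \<and>
     (AE \<omega> in M. B 0 \<omega> = 0) \<and>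
     (AE \<omega> in M. continuous_on {0..} (\<lambda>t. B t \<omega>)) \<and>
     (\<forall>s t i. 0 \<le> s \<and> s < t \<longrightarrow>
        distributed M lborel (\<lambda>\<omega>. (B t \<omega> - B s \<omega>) $ i) (normal_density 0 (sqrt (t - s)))) \<and>
     (\<forall>(\<tau> :: nat \<Rightarrow> real) m. 0 \<le> \<tau> 0 \<and> strict_mono \<tau> \<longrightarrow>
        prob_space.indep_vars M (\<lambda>_. borel)
          (\<lambda>(l, i) \<omega>. (B (\<tau> (Suc l)) \<omega> - B (\<tau> l) \<omega>) $ i) ({..<m} \<times> UNIV))"

definition augmented_filtration ::
    "'a measure \<Rightarrow> (real \<Rightarrow> 'a \<Rightarrow> real ^ 'n::finite) \<Rightarrow> real \<Rightarrow> 'a measure" where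
  "augmented_filtration M B t =
     sigma (space M)
       ({B s -` A \<inter> space M | s A. 0 \<le> s \<and> s \<le> t \<and> A \<in> sets borel} \<union> null_sets M)"

(* The noise is additive, so the stochastic differential equation is an integral equation for each
   path b of the driving Brownian motion. The path may touch the walls of the chamber, where the
   drift is singular (in Isabelle 1 / 0 = 0); as part of the equation, the drift is required to be
   defined at almost every time and to be locally integrable. *)

definition bessel_path ::
    "real \<times> real \<Rightarrow> real ^ 'n::{finite,linorder} \<Rightarrow> (real \<Rightarrow> real ^ 'n::{finite,linorder}) \<Rightarrow> (real \<Rightarrow> real ^ 'n::{finite,linorder}) \<Rightarrow> bool"
  where
  "bessel_path k z b u \<longleftrightarrow>
     continuous_on {0..} u \<and>
     (\<forall>t\<ge>0. u t \<in> weyl_chamber_B) \<and>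
     (AE s in lborel. 0 \<le> s \<longrightarrow> u s \<in> interior weyl_chamber_B) \<and>
     (\<forall>t\<ge>0. set_integrable lborel {0..t} (\<lambda>s. bessel_drift k (u s)) \<and>
            u t = z + b t + (LBINT s:{0..t}. bessel_drift k (u s)))"

(* A family of type B Bessel processes indexed by a set I, with multiplicities k p and starting
   points z p, all of them strong solutions for the same Brownian motion B. A strong solution is
   only determined up to a null set. Since suprema over an uncountable I are sensitive to this, the
   solutions are taken pathwise: one null set serves all p in I. For a singleton I this is the usual
   notion of a strong solution. *)

definition bessel_processes ::
    "'a measure \<Rightarrow> (real \<Rightarrow> 'a \<Rightarrow> real ^ 'n::{finite,linorder}) \<Rightarrow> 'p set \<Rightarrow>
     ('p \<Rightarrow> real \<times> real) \<Rightarrow> ('p \<Rightarrow> real ^ 'n::{finite,linorder}) \<Rightarrow> ('p \<Rightarrow> real \<Rightarrow> 'a \<Rightarrow> real ^ 'n::{finite,linorder}) \<Rightarrow> bool"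
  where
  "bessel_processes M B I k z X \<longleftrightarrow>
     (\<forall>p\<in>I. \<forall>t\<ge>0. X p t \<in> borel_measurable (augmented_filtration M B t)) \<and>
     (AE \<omega> in M. \<forall>p\<in>I. bessel_path (k p) (z p) (\<lambda>t. B t \<omega>) (\<lambda>t. X p t \<omega>))"

(* Paths are continuous only almost surely, so the supremum over [0, T] is in general measurable
   only with respect to the completion of M. *)

definition locally_uniform_in_prob ::
    "'a measure \<Rightarrow> (real \<Rightarrow> real \<Rightarrow> 'a \<Rightarrow> 'b::real_normed_vector) \<Rightarrow> (real \<Rightarrow> 'b) \<Rightarrow> bool" where
  "locally_uniform_in_prob M Y u \<longleftrightarrow>
     (\<forall>T\<ge>0. \<forall>\<epsilon>>0.
        (\<forall>\<^sub>F \<beta> in at_top.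
           {\<omega>\<in>space M. (SUP s\<in>{0..T}. ereal (norm (Y \<beta> s \<omega> - u s))) > ereal \<epsilon>} \<in> sets (completion M)) \<and>
        ((\<lambda>\<beta>. measure (completion M)
           {\<omega>\<in>space M. (SUP s\<in>{0..T}. ereal (norm (Y \<beta> s \<omega> - u s))) > ereal \<epsilon>}) \<longlongrightarrow> 0) at_top)"

end

theory Submission
  imports Defs
begin

text \<open>
  The argument is pathwise. Write \<open>H\<close> for the limit field, \<open>v = sqrt \<beta> \<phi>\<close> and
  \<open>D = X - v - w\<close>, where \<open>w\<close> lies so deep in the chamber that the ball of radius \<open>R \<ge> sup |B|\<close> around
  it stays inside. Since \<open>H\<close> is homogeneous of degree \<open>-1\<close>, the noise cancels in
  \<open>Z = D - B = y - w + \<integral>E\<close> with \<open>E = \<beta> (H X - H v)\<close>. As \<open>H\<close> is the gradient of a concave function, it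
  is monotone; tested at the points \<open>v + w + e\<close> with \<open>|e| \<le> R\<close>, monotonicity gives
  \<open>E \<bullet> D + R |E| \<le> c (|D| + R)\<close> with \<open>c\<close> independent of \<open>\<beta>\<close>. The term \<open>R |E|\<close> absorbs \<open>B \<bullet> E\<close>, so
  \<open>|Z|\<^sup>2\<close> grows at most at rate \<open>2 c (|Z| + 2 R)\<close>, uniformly in \<open>\<beta>\<close>.
\<close>

section \<open>Geometry of the open chamber\<close>

text \<open>The interior of the chamber written in coordinates, so that the signs of all gaps can be
  read off and the cone properties are immediate.\<close>

definition open_chamber_B :: "(real ^ 'n::{finite,linorder}) set" where
  "open_chamber_B = {x. (\<forall>i j. i < j \<longrightarrow> x $ j < x $ i) \<and> (\<forall>i. 0 < x $ i)}"

text \<open>Lowering a single coordinate by \<open>e\<close> stays in the chamber, so each weak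
  inequality at the lowered point is a strict one at \<open>x\<close>.\<close>

lemma interior_weyl_chamber_B_subset:
  "interior weyl_chamber_B \<subseteq> (open_chamber_B :: (real ^ 'n::{finite,linorder}) set)"
proof
  fix x :: "real ^ 'n::{finite,linorder}" assume "x \<in> interior weyl_chamber_B"
  then obtain e where e: "e > 0" "cball x e \<subseteq> weyl_chamber_B"
    by (auto simp: mem_interior_cball)
  have mem: "x - axis i e \<in> weyl_chamber_B" for i
    using e by (intro subsetD[OF e(2)]) (auto simp: dist_norm norm_eq_sqrt_inner inner_axis_axis)
  have "x $ j < x $ i" if "i < j" for i j
  proof -
    have "(x - axis i e) $ j \<le> (x - axis i e) $ i"
      using mem[of i] less_imp_le[OF that] unfolding weyl_chamber_B_def by blast
    then show ?thesis using that e(1) by (simp add: axis_def split: if_splits)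
  qed
  moreover have "0 < x $ i" for i
    using mem[of i] e(1) unfolding weyl_chamber_B_def
    by (auto simp: axis_def dest!: spec[of _ i])
  ultimately show "x \<in> open_chamber_B" by (auto simp: open_chamber_B_def)
qed

lemma open_chamber_B_add:
  "u \<in> open_chamber_B \<Longrightarrow> v \<in> open_chamber_B \<Longrightarrow> u + v \<in> open_chamber_B"
  unfolding open_chamber_B_def by (auto intro: add_strict_mono add_pos_pos)

lemma open_chamber_B_scaleR:
  "0 < c \<Longrightarrow> u \<in> open_chamber_B \<Longrightarrow> c *\<^sub>R u \<in> open_chamber_B"
  unfolding open_chamber_B_def by auto

text \<open>Two chamber points order their coordinates alike, so corresponding gaps have the same
  sign. A positive product records this for \<open>i < j\<close> and \<open>j < i\<close> at
  once.\<close>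

lemma open_chamber_B_gap_prod_pos:
  assumes "u \<in> open_chamber_B" "v \<in> open_chamber_B" "i \<noteq> j"
  shows "0 < (u $ i - u $ j) * (v $ i - v $ j)" "0 < (u $ i + u $ j) * (v $ i + v $ j)"
proof -
  have "i < j \<or> j < i" using assms(3) by auto
  moreover have "u $ j < u $ i" "v $ j < v $ i" if "i < j" for i j
    using assms that by (auto simp: open_chamber_B_def)
  ultimately show "0 < (u $ i - u $ j) * (v $ i - v $ j)"
    by (metis diff_gt_0_iff_gt diff_less_0_iff_less mult_neg_neg mult_pos_pos)
  show "0 < (u $ i + u $ j) * (v $ i + v $ j)"
    using assms by (simp add: open_chamber_B_def add_pos_pos)
qed

text \<open>The chamber is a cone, so a small ball around \<open>x\<close> can be blown up to radius
  \<open>R\<close>. The factor 2 in \<open>2 * R / r\<close> scales \<open>e\<close> back to norm at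
  most \<open>r / 2\<close>, strictly inside the open ball.\<close>

lemma deep_point_ex:
  assumes "x \<in> interior (weyl_chamber_B :: (real ^ 'n::{finite,linorder}) set)" "0 < R"
  obtains w where "\<And>e. norm e \<le> R \<Longrightarrow> w + e \<in> (open_chamber_B :: (real ^ 'n::{finite,linorder}) set)"
proof -
  obtain r where r: "r > 0" "ball x r \<subseteq> interior weyl_chamber_B"
    using assms(1) open_contains_ball open_interior by blast
  have "(2 * R / r) *\<^sub>R x + e \<in> open_chamber_B" if "norm e \<le> R" for e
  proof -
    have "norm ((r / (2 * R)) *\<^sub>R e) < r"
      using that r(1) assms(2) by (auto simp: field_simps intro: le_less_trans)
    then have "x + (r / (2 * R)) *\<^sub>R e \<in> open_chamber_B"
      using r(2) interior_weyl_chamber_B_subset by (force simp: dist_norm)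
    then have "(2 * R / r) *\<^sub>R (x + (r / (2 * R)) *\<^sub>R e) \<in> open_chamber_B"
      by (rule open_chamber_B_scaleR[rotated]) (use r(1) assms(2) in auto)
    then show ?thesis using r(1) assms(2) by (simp add: scaleR_add_right)
  qed
  then show ?thesis using that by blast
qed

section \<open>Monotonicity of the limit field\<close>

text \<open>The reciprocal is decreasing on each half-line; the hypothesis places \<open>p\<close>
  and \<open>q\<close> on the same one.\<close>

lemma diff_inverse_diff_nonpos:
  fixes p q :: real
  assumes "0 < p * q"
  shows "(p - q) * (1 / p - 1 / q) \<le> 0"
proof -
  have "p \<noteq> 0" "q \<noteq> 0" using assms by auto
  then have "(p - q) * (1 / p - 1 / q) = - ((p - q)\<^sup>2 / (p * q))"
    by (simp add: field_simps power2_eq_square)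
  then show ?thesis using assms by simp
qed

text \<open>Symmetrisation: twice the double sum is the sum of each term together with its
  transpose, so a sign for every pair suffices.\<close>

lemma sum_pairs_nonpos:
  fixes F :: "'n::finite \<Rightarrow> 'n \<Rightarrow> real"
  assumes "\<And>i j. i \<noteq> j \<Longrightarrow> c i * F i j + c j * F j i \<le> 0"
  shows "(\<Sum>i\<in>UNIV. c i * (\<Sum>j\<in>UNIV - {i}. F i j)) \<le> 0"
proof -
  \<comment> \<open>The zero diagonal lets both indices range over \<open>UNIV\<close>, so that the
    order of summation can be swapped.\<close>
  define G where "G i j = (if i = j then 0 else c i * F i j)" for i j
  have "c i * (\<Sum>j\<in>UNIV - {i}. F i j) = (\<Sum>j\<in>UNIV. G i j)" for i
  proof -
    have "(\<Sum>j\<in>UNIV. G i j) = G i i + (\<Sum>j\<in>UNIV - {i}. G i j)"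
      by (rule sum.remove) auto
    then show ?thesis by (simp add: G_def sum_distrib_left)
  qed
  then have eq: "(\<Sum>i\<in>UNIV. c i * (\<Sum>j\<in>UNIV - {i}. F i j)) = (\<Sum>i\<in>UNIV. \<Sum>j\<in>UNIV. G i j)"
    by simp
  have "2 * (\<Sum>i\<in>UNIV. \<Sum>j\<in>UNIV. G i j)
      = (\<Sum>i\<in>UNIV. \<Sum>j\<in>UNIV. G i j) + (\<Sum>i\<in>UNIV. \<Sum>j\<in>UNIV. G j i)"
    using sum.swap[of G UNIV UNIV] by simp
  also have "\<dots> = (\<Sum>i\<in>UNIV. \<Sum>j\<in>UNIV. G i j + G j i)"
    by (simp add: sum.distrib)
  also have "\<dots> \<le> 0"
    by (intro sum_nonpos) (use assms in \<open>auto simp: G_def\<close>)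
  finally show ?thesis using eq by simp
qed

text \<open>Shown without the potential: after symmetrisation each root contributes a term
  \<open>(p - q) * (1 / p - 1 / q)\<close>, where \<open>p\<close> and \<open>q\<close> are its
  values at \<open>u\<close> and \<open>v\<close>, and these have equal sign.\<close>

lemma limit_field_monotone:
  fixes u v :: "real ^ 'n::{finite,linorder}"
  assumes u: "u \<in> open_chamber_B" and v: "v \<in> open_chamber_B" and "0 \<le> \<nu>"
  shows "(limit_field \<nu> u - limit_field \<nu> v) \<bullet> (u - v) \<le> 0"
proof -
  define c where "c i = u $ i - v $ i" for i
  define f where "f i j = 1 / (u $ i - u $ j) - 1 / (v $ i - v $ j)" for i j
  define g where "g i j = 1 / (u $ i + u $ j) - 1 / (v $ i + v $ j)" for i j
  have "(limit_field \<nu> u - limit_field \<nu> v) \<bullet> (u - v)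
      = (\<Sum>i\<in>UNIV. c i * (\<Sum>j\<in>UNIV - {i}. f i j + g i j) + \<nu> * (c i * (1 / u $ i - 1 / v $ i)))"
    unfolding inner_vec_def limit_field_def c_def f_def g_def
    by (intro sum.cong) (auto simp: sum.distrib sum_subtractf algebra_simps)
  also have "\<dots> = (\<Sum>i\<in>UNIV. c i * (\<Sum>j\<in>UNIV - {i}. f i j + g i j))
      + \<nu> * (\<Sum>i\<in>UNIV. c i * (1 / u $ i - 1 / v $ i))"
    by (simp add: sum.distrib sum_distrib_left)
  also have "\<dots> \<le> 0 + \<nu> * 0"
  proof (intro add_mono mult_left_mono sum_pairs_nonpos sum_nonpos)
    fix i j :: 'n assume ij: "i \<noteq> j"
    \<comment> \<open>Antisymmetry of \<open>f\<close> and symmetry of \<open>g\<close> combine the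
      coefficients \<open>c i\<close> and \<open>c j\<close> into exactly the difference and the sum
      that match the two kinds of gaps.\<close>
    have "f j i = - f i j"
      using minus_divide_right[of 1 "u $ i - u $ j"] minus_divide_right[of 1 "v $ i - v $ j"]
      by (simp add: f_def)
    moreover have "g j i = g i j" by (simp add: g_def add.commute)
    ultimately have "c i * (f i j + g i j) + c j * (f j i + g j i)
        = (c i - c j) * f i j + (c i + c j) * g i j"
      by (simp add: algebra_simps)
    moreover have "(c i - c j) * f i j \<le> 0"
      using diff_inverse_diff_nonpos[OF open_chamber_B_gap_prod_pos(1)[OF u v ij]]
      by (simp add: c_def f_def algebra_simps)
    moreover have "(c i + c j) * g i j \<le> 0"
      using diff_inverse_diff_nonpos[OF open_chamber_B_gap_prod_pos(2)[OF u v ij]]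
      by (simp add: c_def g_def algebra_simps)
    ultimately show "c i * (f i j + g i j) + c j * (f j i + g j i) \<le> 0" by linarith
  next
    fix i
    show "c i * (1 / u $ i - 1 / v $ i) \<le> 0"
      using diff_inverse_diff_nonpos[of "u $ i" "v $ i"] u v
      by (auto simp: c_def open_chamber_B_def)
  qed (use assms in auto)
  finally show ?thesis by simp
qed

section \<open>Homogeneity and coercivity of the field\<close>

lemma bessel_drift_eq_limit_field: "bessel_drift (\<beta> * \<nu>, \<beta>) u = \<beta> *\<^sub>R limit_field \<nu> u"
  by (simp add: bessel_drift_def limit_field_def vec_eq_iff algebra_simps)

lemma limit_field_scaleR:
  assumes "c \<noteq> 0"
  shows "limit_field \<nu> (c *\<^sub>R u) = limit_field \<nu> u /\<^sub>R c"
proof -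
  have "1 / (c * p - c * q) = 1 / c * (1 / (p - q))" "1 / (c * p + c * q) = 1 / c * (1 / (p + q))" for p q
    by (simp_all add: right_diff_distrib[symmetric] distrib_left[symmetric])
  then show ?thesis
    by (simp add: limit_field_def vec_eq_iff sum_distrib_left distrib_left divide_inverse mult.assoc mult.left_commute)
qed

text \<open>On the open chamber this is minus the divergence of \<open>limit_field \<nu>\<close>. It
  measures the local stiffness of the field and is homogeneous of degree -2.\<close>

definition sum_inverse_squares :: "real \<Rightarrow> real ^ 'n::finite \<Rightarrow> real" where
  "sum_inverse_squares \<nu> v = (\<Sum>i\<in>UNIV.
     (\<Sum>j\<in>UNIV - {i}. 1 / (v $ i - v $ j)\<^sup>2 + 1 / (v $ i + v $ j)\<^sup>2) + \<nu> / (v $ i)\<^sup>2)"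

lemma sum_inverse_squares_scaleR:
  assumes "c \<noteq> 0"
  shows "sum_inverse_squares \<nu> (c *\<^sub>R u) = sum_inverse_squares \<nu> u / c\<^sup>2"
proof -
  have "1 / (c * p - c * q)\<^sup>2 = 1 / c\<^sup>2 * (1 / (p - q)\<^sup>2)" "1 / (c * p + c * q)\<^sup>2 = 1 / c\<^sup>2 * (1 / (p + q)\<^sup>2)" for p q
    by (simp_all add: right_diff_distrib[symmetric] distrib_left[symmetric] power_mult_distrib)
  then have "sum_inverse_squares \<nu> (c *\<^sub>R u) = 1 / c\<^sup>2 * sum_inverse_squares \<nu> u"
    by (simp add: sum_inverse_squares_def sum_distrib_left distrib_left power_mult_distrib)
  then show ?thesis by simp
qed

text \<open>Equal signs of \<open>g\<close> and \<open>h\<close> give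
  \<open>\<bar>g\<bar> \<le> \<bar>g + h\<bar>\<close>, so one factor of the common denominator can
  be replaced by \<open>\<bar>g\<bar>\<close>.\<close>

lemma abs_inverse_diff_le:
  fixes g h :: real
  assumes "0 < g * h"
  shows "\<bar>1 / (g + h) - 1 / g\<bar> \<le> \<bar>h\<bar> / g\<^sup>2"
proof -
  have nz: "g \<noteq> 0" "g + h \<noteq> 0" using assms by (auto simp: add_eq_0_iff2 zero_less_mult_iff)
  then have "\<bar>1 / (g + h) - 1 / g\<bar> = \<bar>h\<bar> / (\<bar>g + h\<bar> * \<bar>g\<bar>)"
    by (simp add: divide_simps abs_mult)
  also have "\<dots> \<le> \<bar>h\<bar> / (\<bar>g\<bar> * \<bar>g\<bar>)"
    using nz assms by (intro divide_left_mono mult_right_mono) (auto simp: zero_less_mult_iff)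
  finally show ?thesis by (simp add: power2_eq_square)
qed

text \<open>Adding a chamber point only widens the gaps of \<open>v\<close>. Hence the change of
  every reciprocal is controlled by the gaps of \<open>v\<close> alone, linearly in \<open>p\<close>
  and however large \<open>p\<close> is. The factor 2 covers \<open>p $ i - p $ j\<close> and
  \<open>p $ i + p $ j\<close>.\<close>

lemma limit_field_diff_le:
  fixes v p :: "real ^ 'n::{finite,linorder}"
  assumes v: "v \<in> open_chamber_B" and p: "p \<in> open_chamber_B" and "0 \<le> \<nu>"
  shows "norm (limit_field \<nu> (v + p) - limit_field \<nu> v) \<le> 2 * norm p * sum_inverse_squares \<nu> v"
proof -
  let ?D = "limit_field \<nu> (v + p) - limit_field \<nu> v"
  have le: "\<bar>p $ i\<bar> \<le> norm p" for i by (rule component_le_norm_cart)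
  have recip: "\<bar>1 / (g + h) - 1 / g\<bar> \<le> 2 * norm p * (1 / g\<^sup>2)"
    if "0 < g * h" "\<bar>h\<bar> \<le> 2 * norm p" for g h
    using abs_inverse_diff_le[OF that(1)] divide_right_mono[OF that(2), of "g\<^sup>2"] by simp
  have "\<bar>?D $ i\<bar> \<le> 2 * norm p *
      ((\<Sum>j\<in>UNIV - {i}. 1 / (v $ i - v $ j)\<^sup>2 + 1 / (v $ i + v $ j)\<^sup>2) + \<nu> / (v $ i)\<^sup>2)" for i
  proof -
    let ?f = "\<lambda>j. 1 / ((v + p) $ i - (v + p) $ j) - 1 / (v $ i - v $ j)"
    let ?g = "\<lambda>j. 1 / ((v + p) $ i + (v + p) $ j) - 1 / (v $ i + v $ j)"
    have eq: "?D $ i = (\<Sum>j\<in>UNIV - {i}. ?f j + ?g j) + \<nu> * (1 / (v $ i + p $ i) - 1 / v $ i)"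
      by (simp add: limit_field_def sum_subtractf sum.distrib algebra_simps)
    have "\<bar>?D $ i\<bar> \<le> (\<Sum>j\<in>UNIV - {i}. \<bar>?f j\<bar> + \<bar>?g j\<bar>) + \<nu> * \<bar>1 / (v $ i + p $ i) - 1 / v $ i\<bar>"
      unfolding eq
    proof (rule order_trans[OF abs_triangle_ineq], rule add_mono)
      show "\<bar>\<Sum>j\<in>UNIV - {i}. ?f j + ?g j\<bar> \<le> (\<Sum>j\<in>UNIV - {i}. \<bar>?f j\<bar> + \<bar>?g j\<bar>)"
        by (rule order_trans[OF sum_abs]) (rule sum_mono, rule abs_triangle_ineq)
    qed (use assms(3) in \<open>simp add: abs_mult\<close>)
    also have "\<dots> \<le> (\<Sum>j\<in>UNIV - {i}. 2 * norm p * (1 / (v $ i - v $ j)\<^sup>2) + 2 * norm p * (1 / (v $ i + v $ j)\<^sup>2))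
        + \<nu> * (2 * norm p * (1 / (v $ i)\<^sup>2))"
    proof (rule add_mono)
      show "(\<Sum>j\<in>UNIV - {i}. \<bar>?f j\<bar> + \<bar>?g j\<bar>) \<le>
        (\<Sum>j\<in>UNIV - {i}. 2 * norm p * (1 / (v $ i - v $ j)\<^sup>2) + 2 * norm p * (1 / (v $ i + v $ j)\<^sup>2))"
      proof (rule sum_mono, rule add_mono)
        fix j assume "j \<in> UNIV - {i}"
        then have ij: "i \<noteq> j" by auto
        have "\<bar>p $ i - p $ j\<bar> \<le> 2 * norm p" "\<bar>p $ i + p $ j\<bar> \<le> 2 * norm p"
          using le[of i] le[of j] by linarith+
        note r = recip[OF open_chamber_B_gap_prod_pos(1)[OF v p ij] this(1)]
          recip[OF open_chamber_B_gap_prod_pos(2)[OF v p ij] this(2)]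
        have "(v + p) $ i - (v + p) $ j = (v $ i - v $ j) + (p $ i - p $ j)"
          "(v + p) $ i + (v + p) $ j = (v $ i + v $ j) + (p $ i + p $ j)" by simp_all
        with r show "\<bar>?f j\<bar> \<le> 2 * norm p * (1 / (v $ i - v $ j)\<^sup>2)"
          "\<bar>?g j\<bar> \<le> 2 * norm p * (1 / (v $ i + v $ j)\<^sup>2)"
          by (simp_all only:)
      qed
      have "\<bar>1 / (v $ i + p $ i) - 1 / v $ i\<bar> \<le> 2 * norm p * (1 / (v $ i)\<^sup>2)"
        using v p le[of i] by (intro recip) (auto simp: open_chamber_B_def)
      then show "\<nu> * \<bar>1 / (v $ i + p $ i) - 1 / v $ i\<bar> \<le> \<nu> * (2 * norm p * (1 / (v $ i)\<^sup>2))"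
        using assms(3) by (rule mult_left_mono)
    qed
    finally show ?thesis
      by (simp add: sum_distrib_left distrib_left mult.commute[of \<nu>])
  qed
  then have "(\<Sum>i\<in>UNIV. \<bar>?D $ i\<bar>) \<le> 2 * norm p * sum_inverse_squares \<nu> v"
    unfolding sum_inverse_squares_def sum_distrib_left by (intro sum_mono) auto
  then show ?thesis using norm_le_l1_cart[of ?D] by linarith
qed

text \<open>Monotonicity between \<open>u\<close> and \<open>v\<close> would only give a sign.
  Comparing \<open>u\<close> with a shifted point \<open>v + w + e\<close> gains the term
  \<open>R * norm D\<close>, at the price of the field difference \<open>F\<close>, which does not
  involve \<open>u\<close> except through the direction of \<open>e\<close>.\<close>

lemma limit_field_coercive:
  fixes u v w :: "real ^ 'n::{finite,linorder}"
  assumes u: "u \<in> open_chamber_B" and v: "v \<in> open_chamber_B" and "0 \<le> \<nu>" "0 < R"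
    and w: "\<And>e. norm e \<le> R \<Longrightarrow> w + e \<in> open_chamber_B"
  defines "D \<equiv> limit_field \<nu> u - limit_field \<nu> v"
  shows "D \<bullet> (u - v - w) + R * norm D
    \<le> 2 * (norm w + R) * sum_inverse_squares \<nu> v * (norm (u - v - w) + R)"
proof -
  \<comment> \<open>Of all shifts of norm at most \<open>R\<close> this one makes
    \<open>- (D \<bullet> e)\<close> largest, namely \<open>R * norm D\<close>. For
    \<open>D = 0\<close> it is the zero vector, since \<open>sgn 0 = 0\<close>.\<close>
  define e where "e = - R *\<^sub>R sgn D"
  define F where "F = limit_field \<nu> (v + (w + e)) - limit_field \<nu> v"
  have e: "norm e \<le> R" using assms(4) by (simp add: e_def norm_sgn)
  have S: "0 \<le> sum_inverse_squares \<nu> v"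
    unfolding sum_inverse_squares_def using assms(3) by (intro sum_nonneg add_nonneg_nonneg) auto
  have "norm F \<le> 2 * norm (w + e) * sum_inverse_squares \<nu> v"
    unfolding F_def by (intro limit_field_diff_le v w e assms)
  also have "\<dots> \<le> 2 * (norm w + R) * sum_inverse_squares \<nu> v"
    using S e norm_triangle_ineq[of w e] by (intro mult_right_mono mult_left_mono) auto
  finally have F: "norm F \<le> 2 * (norm w + R) * sum_inverse_squares \<nu> v" .
  have "(limit_field \<nu> u - limit_field \<nu> (v + (w + e))) \<bullet> (u - (v + (w + e))) \<le> 0"
    by (intro limit_field_monotone u open_chamber_B_add v w e assms)
  \<comment> \<open>The field difference in the previous line is \<open>D - F\<close>; the part with
    \<open>F\<close> moves to the right.\<close>
  then have "D \<bullet> (u - v - w) - D \<bullet> e \<le> F \<bullet> (u - v - w - e)"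
    by (simp add: D_def F_def algebra_simps)
  also have "\<dots> \<le> norm F * norm (u - v - w - e)"
    by (rule norm_cauchy_schwarz)
  also have "\<dots> \<le> 2 * (norm w + R) * sum_inverse_squares \<nu> v * (norm (u - v - w) + R)"
    using F S e norm_triangle_ineq4[of "u - v - w" e] assms(4)
    by (intro mult_mono) auto
  finally have "D \<bullet> (u - v - w) - D \<bullet> e \<le> \<dots>" .
  moreover have "D \<bullet> e = - R * norm D"
    by (cases "D = 0") (simp_all add: e_def sgn_div_norm dot_square_norm power2_eq_square)
  ultimately show ?thesis by simp
qed

section \<open>Growth of the squared norm of an indefinite integral\<close>

lemma set_integral_Icc_combine:
  fixes f :: "real \<Rightarrow> 'a::{banach, second_countable_topology}"
  assumes "set_integrable lborel {a..c} f" "a \<le> b" "b \<le> c"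
  shows "(LBINT s:{a..c}. f s) = (LBINT s:{a..b}. f s) + (LBINT s:{b<..c}. f s)"
proof -
  have "{a..c} = {a..b} \<union> {b<..c}" using assms by auto
  then show ?thesis
    using assms by (auto intro!: set_integral_Un intro: set_integrable_subset)
qed

text \<open>The left side is \<open>(Z t + Z s) \<bullet> (Z t - Z s)\<close>, with the increment an
  integral of \<open>E\<close>. Replacing both \<open>Z t\<close> and \<open>Z s\<close> by
  \<open>Z r\<close> under the integral costs \<open>\<epsilon> * norm (E r)\<close> each and leaves
  \<open>2 * (Z r \<bullet> E r)\<close>.\<close>

lemma norm_square_diff_le:
  fixes Z E :: "real \<Rightarrow> 'a::euclidean_space"
  assumes E: "set_integrable lborel {a..b} E"
    and Z: "\<And>s. s \<in> {a..b} \<Longrightarrow> Z s = Z a + (LBINT r:{a..s}. E r)"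
    and C: "AE r in lborel. r \<in> {a..b} \<longrightarrow> 2 * (Z r \<bullet> E r) \<le> C"
    and st: "a \<le> s" "s \<le> t" "t \<le> b"
    and osc: "\<And>r q. r \<in> {s..t} \<Longrightarrow> q \<in> {s..t} \<Longrightarrow> norm (Z q - Z r) \<le> \<epsilon>"
  shows "(norm (Z t))\<^sup>2 - (norm (Z s))\<^sup>2 \<le> C * (t - s) + 2 * \<epsilon> * (LBINT r:{s<..t}. norm (E r))"
proof -
  have int: "set_integrable lborel {s<..t} E"
    by (rule set_integrable_subset[OF E]) (use st in auto)
  have intn: "set_integrable lborel {s<..t} (\<lambda>r. norm (E r))"
    using int by (rule set_integrable_norm)
  have intc: "set_integrable lborel {s<..t} (\<lambda>r. C)"
    by (rule set_integrable_subset[of _ "{s..t}"]) (auto intro!: borel_integrable_atLeastAtMost')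
  have incr: "Z t - Z s = (LBINT r:{s<..t}. E r)"
    using set_integral_Icc_combine[OF set_integrable_subset[OF E], of a t s] Z[of s] Z[of t] st
    by auto
  have "(norm (Z t))\<^sup>2 - (norm (Z s))\<^sup>2 = (Z t + Z s) \<bullet> (Z t - Z s)"
    by (simp add: power2_norm_eq_inner algebra_simps inner_commute)
  also have "\<dots> = (LBINT r:{s<..t}. (Z t + Z s) \<bullet> E r)"
    using int unfolding incr set_lebesgue_integral_def set_integrable_def
    by (subst integral_inner_right[symmetric]) auto
  also have "\<dots> \<le> (LBINT r:{s<..t}. C + 2 * \<epsilon> * norm (E r))"
  proof (rule set_integral_mono_AE)
    show "set_integrable lborel {s<..t} (\<lambda>r. (Z t + Z s) \<bullet> E r)"
      using integrable_inner_right[of "Z t + Z s", OF int[unfolded set_integrable_def]]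
      by (simp add: set_integrable_def)
    show "set_integrable lborel {s<..t} (\<lambda>r. C + 2 * \<epsilon> * norm (E r))"
      using intn intc by (intro set_integral_add set_integrable_mult_right) auto
    show "AE r\<in>{s<..t} in lborel. (Z t + Z s) \<bullet> E r \<le> C + 2 * \<epsilon> * norm (E r)"
      using C
    proof eventually_elim
      case (elim r)
      show ?case
      proof
        assume r: "r \<in> {s<..t}"
        have "(Z t + Z s) \<bullet> E r = 2 * (Z r \<bullet> E r) + (Z t - Z r) \<bullet> E r + (Z s - Z r) \<bullet> E r"
          by (simp add: algebra_simps)
        moreover have "(Z q - Z r) \<bullet> E r \<le> \<epsilon> * norm (E r)" if "q \<in> {s..t}" for q
          using osc[of r q] that r
          by (intro order_trans[OF norm_cauchy_schwarz] mult_right_mono) auto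
        from this[of t] this[of s]
        have "(Z t - Z r) \<bullet> E r + (Z s - Z r) \<bullet> E r \<le> 2 * \<epsilon> * norm (E r)"
          using st by (simp add: algebra_simps)
        moreover have "2 * (Z r \<bullet> E r) \<le> C" using elim r st by simp
        ultimately show "(Z t + Z s) \<bullet> E r \<le> C + 2 * \<epsilon> * norm (E r)"
          by linarith
      qed
    qed
  qed
  also have "\<dots> = C * (t - s) + 2 * \<epsilon> * (LBINT r:{s<..t}. norm (E r))"
    using intn intc st by (subst set_integral_add) (auto simp: set_integral_const)
  finally show ?thesis .
qed

text \<open>The chain rule for \<open>|Z|\<^sup>2\<close> when \<open>Z\<close> is only an indefinite Lebesgue integral: telescope over a
  partition on whose cells \<open>Z\<close> oscillates by at most \<open>\<epsilon>\<close>.\<close>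

lemma norm_square_le_of_inner_bound:
  fixes Z E :: "real \<Rightarrow> 'a::euclidean_space"
  assumes E: "set_integrable lborel {a..b} E" and ab: "a \<le> b"
    and cont: "continuous_on {a..b} Z"
    and Z: "\<And>s. s \<in> {a..b} \<Longrightarrow> Z s = Z a + (LBINT r:{a..s}. E r)"
    and C: "AE r in lborel. r \<in> {a..b} \<longrightarrow> 2 * (Z r \<bullet> E r) \<le> C"
  shows "(norm (Z b))\<^sup>2 \<le> (norm (Z a))\<^sup>2 + C * (b - a)"
proof (rule field_le_epsilon)
  fix \<eta> :: real assume \<eta>: "\<eta> > 0"
  define J where "J = (LBINT r:{a<..b}. norm (E r))"
  have "J \<ge> 0" unfolding J_def set_lebesgue_integral_def by (intro Bochner_Integration.integral_nonneg) auto
  \<comment> \<open>The summand 1 keeps the denominator positive when \<open>J = 0\<close>.\<close>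
  define \<epsilon> where "\<epsilon> = \<eta> / (2 * (J + 1))"
  have \<epsilon>: "\<epsilon> > 0" "2 * \<epsilon> * J \<le> \<eta>"
    using \<open>J \<ge> 0\<close> \<eta> by (auto simp: \<epsilon>_def field_simps)
  have "uniformly_continuous_on {a..b} Z"
    using cont by (intro compact_uniformly_continuous) auto
  then obtain d where d: "d > 0"
    "\<And>q r. q \<in> {a..b} \<Longrightarrow> r \<in> {a..b} \<Longrightarrow> dist r q < d \<Longrightarrow> dist (Z r) (Z q) < \<epsilon>"
    unfolding uniformly_continuous_on_def using \<epsilon>(1) by metis
  obtain n :: nat where n: "(b - a) / d < real n" using reals_Archimedean2 by blast
  then have n0: "n > 0" using d(1) ab by (cases n) (auto simp: divide_less_0_iff)
  define p where "p k = a + (b - a) * real k / real n" for k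
  have p_le: "p k \<in> {a..b}" if "k \<le> n" for k
  proof -
    have "(b - a) * (real k / real n) \<le> (b - a) * 1"
      using that n0 ab by (intro mult_left_mono) auto
    then show ?thesis using ab by (simp add: p_def)
  qed
  have step: "p (Suc k) - p k = (b - a) / real n" for k
    using n0 by (simp add: p_def field_simps)
  have small: "(b - a) / real n < d" using n d(1) n0 by (simp add: field_simps)
  have mono: "p k \<le> p (Suc k)" for k using step[of k] ab by (simp add: field_simps)
  \<comment> \<open>The errors of the cells add up to \<open>2 * \<epsilon>\<close> times one
    integral of \<open>norm (E r)\<close>, so the total stays below
    \<open>2 * \<epsilon> * J\<close> whatever the number of cells.\<close>
  have "(norm (Z (p k)))\<^sup>2 \<le> (norm (Z a))\<^sup>2 + C * (p k - a)
      + 2 * \<epsilon> * (LBINT r:{a<..p k}. norm (E r))" if "k \<le> n" for k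
    using that
  proof (induction k)
    case 0
    then show ?case by (simp add: p_def set_lebesgue_integral_def)
  next
    case (Suc k)
    have split: "{a<..p (Suc k)} = {a<..p k} \<union> {p k<..p (Suc k)}"
      using mono[of k] p_le[of k] Suc.prems by auto
    have int: "set_integrable lborel {a..b} (\<lambda>r. norm (E r))"
      using E by (rule set_integrable_norm)
    have "(LBINT r:{a<..p (Suc k)}. norm (E r))
        = (LBINT r:{a<..p k}. norm (E r)) + (LBINT r:{p k<..p (Suc k)}. norm (E r))"
      unfolding split
      by (intro set_integral_Un set_integrable_subset[OF int])
        (use p_le[of k] p_le[of "Suc k"] Suc.prems in auto)
    moreover have "(norm (Z (p (Suc k))))\<^sup>2 - (norm (Z (p k)))\<^sup>2
        \<le> C * (p (Suc k) - p k) + 2 * \<epsilon> * (LBINT r:{p k<..p (Suc k)}. norm (E r))"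
    proof (rule norm_square_diff_le[OF E Z C])
      show "norm (Z q - Z r) \<le> \<epsilon>" if "r \<in> {p k..p (Suc k)}" "q \<in> {p k..p (Suc k)}" for r q
      proof -
        have "dist q r < d" using that step[of k] small by (auto simp: dist_real_def)
        then show ?thesis
          using d(2)[of r q] that p_le[of k] p_le[of "Suc k"] Suc.prems
          by (auto simp: dist_norm)
      qed
    qed (use p_le[of k] p_le[of "Suc k"] mono[of k] Suc.prems in auto)
    moreover have "(norm (Z (p k)))\<^sup>2 \<le> (norm (Z a))\<^sup>2 + C * (p k - a)
      + 2 * \<epsilon> * (LBINT r:{a<..p k}. norm (E r))" using Suc by simp
    ultimately show ?case by (simp add: algebra_simps)
  qed
  from this[of n] have "(norm (Z b))\<^sup>2 \<le> (norm (Z a))\<^sup>2 + C * (b - a) + 2 * \<epsilon> * J"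
    using n0 by (simp add: p_def J_def)
  then show "(norm (Z b))\<^sup>2 \<le> (norm (Z a))\<^sup>2 + C * (b - a) + \<eta>"
    using \<epsilon>(2) by linarith
qed

section \<open>Regularity and integral form of the limit flow\<close>

lemma solves_limit_ode_open_chamber:
  assumes "solves_limit_ode \<nu> x f" "0 \<le> s"
  shows "f s \<in> open_chamber_B"
  using assms interior_weyl_chamber_B_subset unfolding solves_limit_ode_def by blast

lemma continuous_on_solves_limit_ode:
  assumes "solves_limit_ode \<nu> x f"
  shows "continuous_on {0..} f"
  using assms unfolding solves_limit_ode_def
  by (auto intro!: continuous_on_vector_derivative)

lemma open_chamber_B_nonzero:
  assumes "u \<in> open_chamber_B"
  shows "u $ i \<noteq> 0" "i \<noteq> j \<Longrightarrow> u $ i - u $ j \<noteq> 0" "i \<noteq> j \<Longrightarrow> u $ i + u $ j \<noteq> 0"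
  using open_chamber_B_gap_prod_pos[OF assms assms, of i j] assms
  by (auto simp: open_chamber_B_def dest: spec[of _ i])

lemma continuous_on_limit_field_compose:
  assumes "continuous_on S f" "\<And>s. s \<in> S \<Longrightarrow> f s \<in> open_chamber_B"
  shows "continuous_on S (\<lambda>s. limit_field \<nu> (f s))"
  unfolding limit_field_def
  by (intro continuous_intros assms(1)) (use open_chamber_B_nonzero[OF assms(2)] in auto)

lemma continuous_on_sum_inverse_squares_compose:
  assumes "continuous_on S f" "\<And>s. s \<in> S \<Longrightarrow> f s \<in> open_chamber_B"
  shows "continuous_on S (\<lambda>s. sum_inverse_squares \<nu> (f s))"
  unfolding sum_inverse_squares_def
  by (intro continuous_intros assms(1)) (use open_chamber_B_nonzero[OF assms(2)] in auto)

text \<open>Brings the flow into the integral form of \<open>bessel_path\<close>, so that the two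
  equations can be subtracted.\<close>

lemma solves_limit_ode_integral:
  assumes "solves_limit_ode \<nu> x f" "0 \<le> s"
  shows "set_integrable lborel {0..s} (\<lambda>r. limit_field \<nu> (f r))"
    and "f s = x + (LBINT r:{0..s}. limit_field \<nu> (f r))"
proof -
  have cont: "continuous_on {0..s} (\<lambda>r. limit_field \<nu> (f r))"
    by (intro continuous_on_limit_field_compose continuous_on_subset[OF continuous_on_solves_limit_ode[OF assms(1)]]
        solves_limit_ode_open_chamber[OF assms(1)]) auto
  then show "set_integrable lborel {0..s} (\<lambda>r. limit_field \<nu> (f r))"
    by (rule borel_integrable_atLeastAtMost')
  have "(LBINT r:{0..s}. limit_field \<nu> (f r)) = f s - f 0"
    unfolding set_lebesgue_integral_def
  proof (rule integral_FTC_atLeastAtMost[OF assms(2) _ cont])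
    show "(f has_vector_derivative limit_field \<nu> (f r)) (at r within {0..s})" if "0 \<le> r" "r \<le> s" for r
      using assms(1) that unfolding solves_limit_ode_def
      by (auto intro: has_vector_derivative_within_subset)
  qed
  then show "f s = x + (LBINT r:{0..s}. limit_field \<nu> (f r))"
    using assms(1) by (simp add: solves_limit_ode_def)
qed

section \<open>Pathwise bound, uniform in \<beta>\<close>

text \<open>For \<open>m > 1\<close> one has \<open>A \<le> A * m\<close>, and a factor
  \<open>m\<close> cancels. This turns a bound on the maximum of \<open>norm Z\<close> in terms of
  itself into an explicit one.\<close>

lemma quadratic_bound:
  fixes m A B :: real
  assumes "m\<^sup>2 \<le> A + B * m" "0 \<le> A" "0 \<le> B" "0 \<le> m"
  shows "m \<le> 1 + A + B"
proof (cases "m \<le> 1")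
  case False
  have "m * m \<le> m * (A + B)"
    using assms False mult_right_mono[of 1 m A] by (simp add: power2_eq_square algebra_simps)
  then show ?thesis using False assms by (simp add: mult_le_cancel_left)
qed (use assms in linarith)

lemma bessel_path_dist_bounded:
  fixes x y :: "real ^ 'n::{finite,linorder}"
  assumes "0 \<le> \<nu>" and x: "x \<in> interior weyl_chamber_B" and ode: "solves_limit_ode \<nu> x f"
    and b: "continuous_on {0..} b"
  obtains K where "\<And>\<beta> u s. 0 < \<beta> \<Longrightarrow> bessel_path (\<beta> * \<nu>, \<beta>) (sqrt \<beta> *\<^sub>R x + y) b u \<Longrightarrow>
    s \<in> {0..T} \<Longrightarrow> norm (u s - sqrt \<beta> *\<^sub>R f s) \<le> K"
proof -
  have "bounded (b ` {0..T})"
    by (intro compact_imp_bounded compact_continuous_image continuous_on_subset[OF b]) auto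
  then obtain R where R: "R > 0" "\<And>s. s \<in> {0..T} \<Longrightarrow> norm (b s) \<le> R"
    unfolding bounded_pos by auto
  have fcont: "continuous_on {0..T} f"
    using continuous_on_subset[OF continuous_on_solves_limit_ode[OF ode]] by auto
  have "bounded ((\<lambda>s. sum_inverse_squares \<nu> (f s)) ` {0..T})"
    by (intro compact_imp_bounded compact_continuous_image continuous_on_sum_inverse_squares_compose
        fcont solves_limit_ode_open_chamber[OF ode]) auto
  \<comment> \<open>Finite because the flow stays in the open chamber, hence away from the walls on
    the compact interval.\<close>
  then obtain G where G: "G > 0" "\<And>s. s \<in> {0..T} \<Longrightarrow> sum_inverse_squares \<nu> (f s) \<le> G"
    unfolding bounded_pos by (metis abs_le_D1 image_eqI real_norm_def)
  obtain w :: "real ^ 'n::{finite,linorder}" where w: "\<And>e. norm e \<le> R \<Longrightarrow> w + e \<in> open_chamber_B"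
    using deep_point_ex[OF x R(1)] by blast
  define c where "c = 2 * (norm w + R) * G"
  have c: "c \<ge> 0" using R G by (simp add: c_def)
  \<comment> \<open>The output of \<open>quadratic_bound\<close> for the inequality at the maximiser
    of \<open>norm Z\<close> below. Only \<open>y\<close>, \<open>w\<close>, \<open>c\<close>,
    \<open>R\<close> and \<open>T\<close> enter, so it is fixed before \<beta> and
    \<open>u\<close>.\<close>
  define K where "K = 1 + ((norm (y - w))\<^sup>2 + 2 * c * (2 * R) * T) + 2 * c * T"
  have "norm (u s - sqrt \<beta> *\<^sub>R f s) \<le> K + R + norm w"
    if \<beta>: "0 < \<beta>" and u: "bessel_path (\<beta> * \<nu>, \<beta>) (sqrt \<beta> *\<^sub>R x + y) b u" and s: "s \<in> {0..T}" for \<beta> u s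
  proof -
    define v where "v r = sqrt \<beta> *\<^sub>R f r" for r
    define E where "E r = \<beta> *\<^sub>R (limit_field \<nu> (u r) - limit_field \<nu> (v r))" for r
    define Z where "Z r = u r - v r - w - b r" for r
    have T: "0 \<le> T" using s by auto
    \<comment> \<open>By homogeneity of degree -1, \<open>\<beta>\<close> times the field at
      \<open>v r\<close> is \<open>sqrt \<beta>\<close> times the field at \<open>f r\<close>, that
      is, the velocity of \<open>v\<close>.\<close>
    have E_eq: "E r = bessel_drift (\<beta> * \<nu>, \<beta>) (u r) - sqrt \<beta> *\<^sub>R limit_field \<nu> (f r)" for r
      using \<beta> by (simp add: E_def v_def bessel_drift_eq_limit_field limit_field_scaleR
          scaleR_diff_right inverse_eq_divide real_div_sqrt)
    have int: "set_integrable lborel {0..r} E"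
      and Z_eq: "Z r = (y - w) + (LBINT q:{0..r}. E q)" if "0 \<le> r" for r
    proof -
      have drift: "set_integrable lborel {0..r} (\<lambda>q. bessel_drift (\<beta> * \<nu>, \<beta>) (u q))"
        "u r = sqrt \<beta> *\<^sub>R x + y + b r + (LBINT q:{0..r}. bessel_drift (\<beta> * \<nu>, \<beta>) (u q))"
        using u that unfolding bessel_path_def by auto
      have lim: "set_integrable lborel {0..r} (\<lambda>q. sqrt \<beta> *\<^sub>R limit_field \<nu> (f q))"
        using solves_limit_ode_integral(1)[OF ode that] by (rule set_integrable_scaleR_right[rotated])
      show "set_integrable lborel {0..r} E"
        unfolding E_eq using drift(1) lim by (rule set_integral_diff)
      have "(LBINT q:{0..r}. E q) = (LBINT q:{0..r}. bessel_drift (\<beta> * \<nu>, \<beta>) (u q))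
          - sqrt \<beta> *\<^sub>R (LBINT q:{0..r}. limit_field \<nu> (f q))"
        unfolding E_eq using drift(1) lim by simp
      then show "Z r = (y - w) + (LBINT q:{0..r}. E q)"
        using drift(2) solves_limit_ode_integral(2)[OF ode that]
        by (simp add: Z_def v_def scaleR_add_right)
    qed
    have "(LBINT q:{0..0}. E q) = 0"
      using set_borel_integral_eq_integral(2)[OF int[of 0]] by simp
    then have Z0: "Z 0 = y - w" using Z_eq[of 0] by simp
    have Zcont: "continuous_on {0..T} Z"
      using continuous_on_subset[of _ u "{0..T}"] u continuous_on_subset[OF b, of "{0..T}"] fcont
      unfolding Z_def v_def bessel_path_def by (intro continuous_intros) auto
    \<comment> \<open>Stopping at a maximiser of \<open>norm Z\<close> replaces a Gronwall argument:
      up to \<open>t\<close> the growth rate is at most the constant \<open>C\<close>, which is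
      affine in \<open>norm (Z t)\<close>, and so a quadratic inequality for
      \<open>norm (Z t)\<close> results.\<close>
    obtain t where t: "t \<in> {0..T}" "\<And>r. r \<in> {0..T} \<Longrightarrow> norm (Z r) \<le> norm (Z t)"
      using continuous_attains_sup[OF _ _ continuous_on_norm[OF Zcont]] T by auto
    define C where "C = 2 * c * (norm (Z t) + 2 * R)"
    have C: "C \<ge> 0" using c R by (simp add: C_def)
    \<comment> \<open>Only almost every \<open>r\<close> is available: \<open>u\<close> may touch
      the walls, while coercivity requires \<open>u r\<close> in the open chamber.\<close>
    have "AE r in lborel. r \<in> {0..t} \<longrightarrow> 2 * (Z r \<bullet> E r) \<le> C"
      using u[unfolded bessel_path_def, THEN conjunct2, THEN conjunct2, THEN conjunct1]
    proof eventually_elim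
      case (elim r)
      show ?case
      proof
        assume r: "r \<in> {0..t}"
        then have rT: "r \<in> {0..T}" using t by auto
        define D where "D = limit_field \<nu> (u r) - limit_field \<nu> (v r)"
        define d where "d = u r - v r - w"
        have ur: "u r \<in> open_chamber_B"
          using elim r interior_weyl_chamber_B_subset by auto
        have vr: "v r \<in> open_chamber_B"
          unfolding v_def using \<beta> r
          by (intro open_chamber_B_scaleR solves_limit_ode_open_chamber[OF ode]) auto
        have "D \<bullet> d + R * norm D \<le> 2 * (norm w + R) * sum_inverse_squares \<nu> (v r) * (norm d + R)"
          unfolding D_def d_def by (intro limit_field_coercive ur vr assms R w)
        then have "\<beta> * (D \<bullet> d + R * norm D)
            \<le> \<beta> * (2 * (norm w + R) * sum_inverse_squares \<nu> (v r) * (norm d + R))"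
          using \<beta> by (intro mult_left_mono) auto
        \<comment> \<open>Degree -2 at \<open>v r = sqrt \<beta> *\<^sub>R f r\<close> yields
          \<open>1 / \<beta>\<close>, which removes \<beta> from the right side.\<close>
        also have "\<dots> = 2 * (norm w + R) * sum_inverse_squares \<nu> (f r) * (norm d + R)"
          using \<beta> by (simp add: v_def sum_inverse_squares_scaleR)
        also have "\<dots> \<le> c * (norm d + R)"
          unfolding c_def using G(2)[OF rT] R by (intro mult_right_mono mult_left_mono) auto
        finally have co: "E r \<bullet> d + R * norm (E r) \<le> c * (norm d + R)"
          using \<beta> by (simp add: E_def D_def[symmetric] algebra_simps)
        have "Z r = d - b r" by (simp add: Z_def d_def)
        then have "2 * (Z r \<bullet> E r) = 2 * (E r \<bullet> d) - 2 * (b r \<bullet> E r)"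
          by (simp add: inner_diff_left inner_diff_right inner_commute)
        also have "\<dots> \<le> 2 * (E r \<bullet> d) + 2 * (R * norm (E r))"
        proof -
          have "- (b r \<bullet> E r) \<le> norm (b r) * norm (E r)"
            using Cauchy_Schwarz_ineq2[of "b r" "E r"] by linarith
          also have "\<dots> \<le> R * norm (E r)" using R(2)[OF rT] by (intro mult_right_mono) auto
          finally show ?thesis by linarith
        qed
        also have "\<dots> \<le> 2 * (c * (norm d + R))" using co by linarith
        also have "\<dots> \<le> 2 * (c * (norm (Z t) + 2 * R))"
        proof -
          have "norm d \<le> norm (Z r) + norm (b r)"
            using norm_triangle_ineq[of "Z r" "b r"] by (simp add: Z_def d_def)
          then have "norm d + R \<le> norm (Z t) + 2 * R"
            using t(2)[OF rT] R(2)[OF rT] by linarith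
          then show ?thesis using c by (intro mult_left_mono) auto
        qed
        finally show "2 * (Z r \<bullet> E r) \<le> C" by (simp add: C_def)
      qed
    qed
    then have "(norm (Z t))\<^sup>2 \<le> (norm (Z 0))\<^sup>2 + C * (t - 0)"
      using t(1) int[of t] Z_eq Z0
      by (intro norm_square_le_of_inner_bound[where E = E] continuous_on_subset[OF Zcont]) auto
    also have "\<dots> \<le> (norm (y - w))\<^sup>2 + C * T"
      using t(1) C by (auto simp: Z0 intro: mult_left_mono)
    also have "\<dots> = ((norm (y - w))\<^sup>2 + 2 * c * (2 * R) * T) + 2 * c * T * norm (Z t)"
      by (simp add: C_def algebra_simps)
    finally have "norm (Z t) \<le> K"
      unfolding K_def using c R T by (intro quadratic_bound) auto
    then have "norm (Z s) \<le> K" using t(2)[OF s] by linarith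
    moreover have "u s - sqrt \<beta> *\<^sub>R f s = Z s + b s + w" by (simp add: Z_def v_def)
    ultimately show ?thesis
      using R(2)[OF s] norm_triangle_ineq[of "Z s + b s" w] norm_triangle_ineq[of "Z s" "b s"]
      by (simp only:)
  qed
  then show ?thesis using that by blast
qed

section \<open>Measurability of the supremum and convergence in probability\<close>

text \<open>The augmentation adds null sets of \<open>M\<close> itself, which are measurable in
  \<open>M\<close>, so all generators of the filtration lie in \<open>sets M\<close>.\<close>

lemma borel_measurable_augmented_filtrationD:
  assumes "brownian_motion M B" "f \<in> borel_measurable (augmented_filtration M B t)"
  shows "f \<in> borel_measurable M"
proof -
  let ?A = "{B s -` A \<inter> space M | s A. 0 \<le> s \<and> s \<le> t \<and> A \<in> sets borel} \<union> null_sets M"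
  have A: "?A \<subseteq> sets M"
    using assms(1) unfolding brownian_motion_def by (auto intro: measurable_sets)
  have "sets (augmented_filtration M B t) \<subseteq> sets M"
    unfolding augmented_filtration_def
    using A sets.sigma_sets_subset[OF A] sets.sets_into_space by (subst sets_measure_of) blast+
  moreover have "space (augmented_filtration M B t) = space M"
    unfolding augmented_filtration_def
    using A sets.sets_into_space by (subst space_measure_of) blast+
  ultimately show ?thesis
    using assms(2) by (auto simp: measurable_def)
qed

text \<open>On a continuous path the level is exceeded on \<open>S\<close> iff it is exceeded on a
  countable dense subset. The second event lies in \<open>sets M\<close>, and the two agree up to a
  null set.\<close>

lemma sup_event_in_completion:
  fixes f :: "real \<Rightarrow> 'a \<Rightarrow> real"
  assumes meas: "\<And>s. s \<in> S \<Longrightarrow> f s \<in> borel_measurable M"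
    and cont: "AE \<omega> in M. continuous_on S (\<lambda>s. f s \<omega>)" and "closed S"
  shows "{\<omega>\<in>space M. (SUP s\<in>S. ereal (f s \<omega>)) > ereal \<epsilon>} \<in> sets (completion M)"
proof -
  obtain D where D: "countable D" "D \<subseteq> S" "S \<subseteq> closure D"
    using separable[of S] by blast
  interpret completion: complete_measure "completion M" ..
  let ?A = "{\<omega>\<in>space M. \<exists>s\<in>D. f s \<omega> > \<epsilon>}"
  have "?A = (\<Union>s\<in>D. {\<omega>\<in>space M. f s \<omega> > \<epsilon>})" by auto
  also have "\<dots> \<in> sets M"
    using D(1,2) meas by (intro sets.countable_UN'') (auto simp: borel_measurable_iff_greater)
  finally have A: "?A \<in> sets (completion M)" by simp
  have "AE \<omega> in completion M. \<omega> \<in> ?A \<longleftrightarrow> \<omega> \<in> {\<omega>\<in>space M. (SUP s\<in>S. ereal (f s \<omega>)) > ereal \<epsilon>}"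
    using AE_completion[OF cont]
  proof eventually_elim
    case (elim \<omega>)
    have cl: "closure D = S"
      using D assms(3) by (simp add: closure_minimal subset_antisym)
    have "f s \<omega> \<le> \<epsilon>" if "\<forall>s\<in>D. f s \<omega> \<le> \<epsilon>" "s \<in> S" for s
      using continuous_le_on_closure[of D "\<lambda>s. f s \<omega>" s \<epsilon>] elim that cl by auto
    then have "(\<exists>s\<in>D. \<epsilon> < f s \<omega>) \<longleftrightarrow> (\<exists>s\<in>S. \<epsilon> < f s \<omega>)"
      using D(2) by (meson not_le subsetD)
    then show ?case by (simp add: less_SUP_iff)
  qed
  then show ?thesis
    by (rule completion.in_sets_AE[OF _ A]) auto
qed

text \<open>Dominated convergence for the indicators, with the integrable bound 1.\<close>

lemma (in prob_space) tendsto_prob_0: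
  fixes S :: "real \<Rightarrow> 'a set"
  assumes "\<And>\<beta>. \<beta> \<ge> \<beta>\<^sub>0 \<Longrightarrow> S \<beta> \<in> events"
    and "AE \<omega> in M. \<forall>\<^sub>F \<beta> in at_top. \<omega> \<notin> S \<beta>"
  shows "((\<lambda>\<beta>. prob (S \<beta>)) \<longlongrightarrow> 0) at_top"
proof -
  \<comment> \<open>Freezing the family below \<open>\<beta>\<^sub>0\<close> makes every member
    measurable and changes nothing for large \<beta>.\<close>
  define S' where "S' \<beta> = S (max \<beta> \<beta>\<^sub>0)" for \<beta>
  have S': "S' \<beta> \<in> events" for \<beta> using assms(1) by (simp add: S'_def)
  have ev: "\<forall>\<^sub>F \<beta> in at_top. S \<beta> = S' \<beta>"
    using eventually_ge_at_top[of \<beta>\<^sub>0] by eventually_elim (simp add: S'_def max_def)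
  have "((\<lambda>\<beta>. \<integral>\<omega>. indicator (S' \<beta>) \<omega> \<partial>M) \<longlongrightarrow> (\<integral>\<omega>. (0::real) \<partial>M)) at_top"
  proof (rule integral_dominated_convergence_at_top[where w = "\<lambda>_. 1"])
    show "AE \<omega> in M. ((\<lambda>\<beta>. indicator (S' \<beta>) \<omega> :: real) \<longlongrightarrow> 0) at_top"
      using assms(2)
    proof eventually_elim
      case (elim \<omega>)
      then have "\<forall>\<^sub>F \<beta> in at_top. indicator (S' \<beta>) \<omega> = (0::real)"
        using ev by eventually_elim auto
      then show ?case by (rule tendsto_eventually)
    qed
  qed (use S' in \<open>auto simp: indicator_def\<close>)
  then have "((\<lambda>\<beta>. prob (S' \<beta>)) \<longlongrightarrow> 0) at_top"
    using S' by (simp add: Int_absorb2 sets.sets_into_space)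
  moreover have "\<forall>\<^sub>F \<beta> in at_top. prob (S' \<beta>) = prob (S \<beta>)"
    using ev by eventually_elim simp
  ultimately show ?thesis by (rule Lim_transform_eventually)
qed

section \<open>From the pathwise bound to almost sure and stochastic convergence\<close>

theorem theorem3p5:
  fixes M :: "'a measure"
    and B :: "real \<Rightarrow> 'a \<Rightarrow> real ^ 'n::{finite,linorder}"
    and X :: "real \<Rightarrow> real \<Rightarrow> 'a \<Rightarrow> real ^ 'n::{finite,linorder}"
    and \<phi> :: "real \<Rightarrow> real ^ 'n::{finite,linorder} \<Rightarrow> real ^ 'n::{finite,linorder}"
    and x y :: "real ^ 'n::{finite,linorder}"
    and \<nu> \<beta>\<^sub>0 :: real
  assumes "brownian_motion M B"
    and "\<nu> > 0"
    and "x \<in> interior weyl_chamber_B"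
    and "solves_limit_ode \<nu> x (\<lambda>t. \<phi> t x)"
    and "\<beta>\<^sub>0 \<ge> 1 / 2"
    and "\<forall>\<beta>\<ge>\<beta>\<^sub>0. sqrt \<beta> *\<^sub>R x + y \<in> interior weyl_chamber_B"
    and "bessel_processes M B {\<beta>\<^sub>0..} (\<lambda>\<beta>. (\<beta> * \<nu>, \<beta>)) (\<lambda>\<beta>. sqrt \<beta> *\<^sub>R x + y) X"
  shows "(\<forall>t>0. AE \<omega> in M.
            (SUP (s, \<beta>)\<in>{0..t} \<times> {\<beta>\<^sub>0..}. ereal (norm (X \<beta> s \<omega> - sqrt \<beta> *\<^sub>R \<phi> s x))) < \<infinity>)
       \<and> (AE \<omega> in M. \<forall>T\<ge>0.
            uniform_limit {0..T} (\<lambda>\<beta> s. X \<beta> s \<omega> /\<^sub>R sqrt \<beta>) (\<lambda>s. \<phi> s x) at_top)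
       \<and> locally_uniform_in_prob M (\<lambda>\<beta> s \<omega>. X \<beta> s \<omega> /\<^sub>R sqrt \<beta>) (\<lambda>s. \<phi> s x)"
proof -
  have \<beta>_pos: "0 < \<beta>" if "\<beta>\<^sub>0 \<le> \<beta>" for \<beta> using assms(5) that by linarith
  have path: "AE \<omega> in M. \<forall>\<beta>\<ge>\<beta>\<^sub>0.
      bessel_path (\<beta> * \<nu>, \<beta>) (sqrt \<beta> *\<^sub>R x + y) (\<lambda>t. B t \<omega>) (\<lambda>t. X \<beta> t \<omega>)"
    using assms(7) unfolding bessel_processes_def Ball_def atLeast_iff by (rule conjunct2)
  have "AE \<omega> in M. continuous_on {0..} (\<lambda>t. B t \<omega>)"
    using assms(1) unfolding brownian_motion_def by blast
  \<comment> \<open>One null set serves all \<open>T\<close> and all \<beta>, since the pathwise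
    bound applies to every \<beta> on the same path of the Brownian motion.\<close>
  with path have bound: "AE \<omega> in M. \<forall>T. \<exists>K. \<forall>\<beta>\<ge>\<beta>\<^sub>0. \<forall>s\<in>{0..T}.
      norm (X \<beta> s \<omega> - sqrt \<beta> *\<^sub>R \<phi> s x) \<le> K"
  proof eventually_elim
    case (elim \<omega>)
    show ?case
    proof
      fix T
      obtain K where "\<And>\<beta> u s. 0 < \<beta> \<Longrightarrow> bessel_path (\<beta> * \<nu>, \<beta>) (sqrt \<beta> *\<^sub>R x + y) (\<lambda>t. B t \<omega>) u \<Longrightarrow>
          s \<in> {0..T} \<Longrightarrow> norm (u s - sqrt \<beta> *\<^sub>R \<phi> s x) \<le> K"
        using bessel_path_dist_bounded[OF less_imp_le[OF assms(2)] assms(3,4) elim(2)] by blast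
      then show "\<exists>K. \<forall>\<beta>\<ge>\<beta>\<^sub>0. \<forall>s\<in>{0..T}. norm (X \<beta> s \<omega> - sqrt \<beta> *\<^sub>R \<phi> s x) \<le> K"
        using elim(1) \<beta>_pos by blast
    qed
  qed
  have sup: "AE \<omega> in M.
      (SUP (s, \<beta>)\<in>{0..t} \<times> {\<beta>\<^sub>0..}. ereal (norm (X \<beta> s \<omega> - sqrt \<beta> *\<^sub>R \<phi> s x))) < \<infinity>" for t
    using bound
  proof eventually_elim
    case (elim \<omega>)
    then obtain K where K: "\<forall>\<beta>\<ge>\<beta>\<^sub>0. \<forall>s\<in>{0..t}. norm (X \<beta> s \<omega> - sqrt \<beta> *\<^sub>R \<phi> s x) \<le> K" by blast
    then have "(SUP (s, \<beta>)\<in>{0..t} \<times> {\<beta>\<^sub>0..}. ereal (norm (X \<beta> s \<omega> - sqrt \<beta> *\<^sub>R \<phi> s x))) \<le> ereal K"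
      by (intro SUP_least) auto
    then show ?case by (rule order.strict_trans1) simp
  qed
  have unif: "AE \<omega> in M. \<forall>T\<ge>0.
      uniform_limit {0..T} (\<lambda>\<beta> s. X \<beta> s \<omega> /\<^sub>R sqrt \<beta>) (\<lambda>s. \<phi> s x) at_top"
    using bound
  proof eventually_elim
    case (elim \<omega>)
    show ?case
    proof (intro allI impI uniform_limitI)
      fix T e :: real assume "0 \<le> T" "0 < e"
      obtain K where K: "\<And>\<beta> s. \<beta> \<ge> \<beta>\<^sub>0 \<Longrightarrow> s \<in> {0..T} \<Longrightarrow> norm (X \<beta> s \<omega> - sqrt \<beta> *\<^sub>R \<phi> s x) \<le> K"
        using elim by meson
      \<comment> \<open>After division by \<open>sqrt \<beta>\<close> the bound \<open>K\<close>
        becomes a rate of convergence that is uniform in \<open>s\<close>.\<close>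
      have "((\<lambda>\<beta>. K / sqrt \<beta>) \<longlongrightarrow> 0) at_top"
        by (intro tendsto_divide_0[OF tendsto_const] filterlim_at_top_imp_at_infinity sqrt_at_top)
      then have "\<forall>\<^sub>F \<beta> in at_top. K / sqrt \<beta> < e"
        using \<open>0 < e\<close> by (rule order_tendstoD)
      then show "\<forall>\<^sub>F \<beta> in at_top. \<forall>s\<in>{0..T}. dist (X \<beta> s \<omega> /\<^sub>R sqrt \<beta>) (\<phi> s x) < e"
        using eventually_ge_at_top[of \<beta>\<^sub>0]
      proof eventually_elim
        case (elim \<beta>)
        have \<beta>: "0 < sqrt \<beta>" using \<beta>_pos elim by simp
        show ?case
        proof
          fix s assume s: "s \<in> {0..T}"
          have "X \<beta> s \<omega> /\<^sub>R sqrt \<beta> - \<phi> s x = (X \<beta> s \<omega> - sqrt \<beta> *\<^sub>R \<phi> s x) /\<^sub>R sqrt \<beta>"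
            using \<beta> by (simp add: scaleR_diff_right)
          then have "dist (X \<beta> s \<omega> /\<^sub>R sqrt \<beta>) (\<phi> s x) = norm (X \<beta> s \<omega> - sqrt \<beta> *\<^sub>R \<phi> s x) / sqrt \<beta>"
            using \<beta> by (simp add: dist_norm divide_inverse mult.commute)
          also have "\<dots> \<le> K / sqrt \<beta>"
            using K[OF elim(2) s] \<beta> by (intro divide_right_mono) auto
          finally show "dist (X \<beta> s \<omega> /\<^sub>R sqrt \<beta>) (\<phi> s x) < e" using elim(1) by linarith
        qed
      qed
    qed
  qed
  have "locally_uniform_in_prob M (\<lambda>\<beta> s \<omega>. X \<beta> s \<omega> /\<^sub>R sqrt \<beta>) (\<lambda>s. \<phi> s x)"
    unfolding locally_uniform_in_prob_def
  proof (intro allI impI)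
    fix T \<epsilon> :: real assume T: "0 \<le> T" and \<epsilon>: "0 < \<epsilon>"
    define S where "S \<beta> = {\<omega>\<in>space M. (SUP s\<in>{0..T}. ereal (norm (X \<beta> s \<omega> /\<^sub>R sqrt \<beta> - \<phi> s x))) > ereal \<epsilon>}" for \<beta>
    have S: "S \<beta> \<in> sets (completion M)" if \<beta>: "\<beta> \<ge> \<beta>\<^sub>0" for \<beta>
      unfolding S_def
    proof (rule sup_event_in_completion)
      fix s assume "s \<in> {0..T}"
      then have "X \<beta> s \<in> borel_measurable M"
        using assms(7) \<beta> unfolding bessel_processes_def
        by (intro borel_measurable_augmented_filtrationD[OF assms(1)]) auto
      then show "(\<lambda>\<omega>. norm (X \<beta> s \<omega> /\<^sub>R sqrt \<beta> - \<phi> s x)) \<in> borel_measurable M"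
        by measurable
    next
      have \<phi>: "continuous_on {0..T} (\<lambda>s. \<phi> s x)"
        using continuous_on_subset[OF continuous_on_solves_limit_ode[OF assms(4)]] by auto
      show "AE \<omega> in M. continuous_on {0..T} (\<lambda>s. norm (X \<beta> s \<omega> /\<^sub>R sqrt \<beta> - \<phi> s x))"
        using path
      proof eventually_elim
        case (elim \<omega>)
        then have "continuous_on {0..} (\<lambda>s. X \<beta> s \<omega>)"
          using \<beta> unfolding bessel_path_def by blast
        then have "continuous_on {0..T} (\<lambda>s. X \<beta> s \<omega>)"
          by (rule continuous_on_subset) auto
        with \<phi> show ?case by (intro continuous_intros)
      qed
    qed auto
    have "AE \<omega> in M. \<forall>\<^sub>F \<beta> in at_top. \<omega> \<notin> S \<beta>"
      using unif
    proof eventually_elim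
      case (elim \<omega>)
      then have "\<forall>\<^sub>F \<beta> in at_top. \<forall>s\<in>{0..T}. dist (X \<beta> s \<omega> /\<^sub>R sqrt \<beta>) (\<phi> s x) < \<epsilon>"
        using T \<epsilon> uniform_limitD by blast
      then show ?case
      proof eventually_elim
        case (elim \<beta>)
        \<comment> \<open>The strict bound at each time gives only a weak one for the supremum,
          which suffices because \<open>S \<beta>\<close> asks for a strict excess.\<close>
        then have "(SUP s\<in>{0..T}. ereal (norm (X \<beta> s \<omega> /\<^sub>R sqrt \<beta> - \<phi> s x))) \<le> ereal \<epsilon>"
          by (intro SUP_least) (auto simp: dist_norm intro: less_imp_le)
        then show ?case by (simp add: S_def not_less)
      qed
    qed
    \<comment> \<open>The limit of probabilities is taken in the completion, where the events
      \<open>S \<beta>\<close> are known to be measurable.\<close>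
    then have "AE \<omega> in completion M. \<forall>\<^sub>F \<beta> in at_top. \<omega> \<notin> S \<beta>"
      by (rule AE_completion)
    moreover have "prob_space (completion M)"
      using assms(1) prob_space.prob_space_completion unfolding brownian_motion_def by blast
    ultimately have "((\<lambda>\<beta>. measure (completion M) (S \<beta>)) \<longlongrightarrow> 0) at_top"
      using S by (intro prob_space.tendsto_prob_0)
    moreover have "\<forall>\<^sub>F \<beta> in at_top. S \<beta> \<in> sets (completion M)"
      using eventually_ge_at_top[of \<beta>\<^sub>0] by eventually_elim (rule S)
    ultimately show "(\<forall>\<^sub>F \<beta> in at_top.
        {\<omega>\<in>space M. (SUP s\<in>{0..T}. ereal (norm (X \<beta> s \<omega> /\<^sub>R sqrt \<beta> - \<phi> s x))) > ereal \<epsilon>} \<in> sets (completion M)) \<and>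
      ((\<lambda>\<beta>. measure (completion M)
        {\<omega>\<in>space M. (SUP s\<in>{0..T}. ereal (norm (X \<beta> s \<omega> /\<^sub>R sqrt \<beta> - \<phi> s x))) > ereal \<epsilon>}) \<longlongrightarrow> 0) at_top"
      unfolding S_def by blast
  qed
  with sup unif show ?thesis by blast
qed

end
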